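(* Consider a multi-commodity transportation network (MTN) and let $\lambda\in\Lambda$ be an exogenous inflow array within its stability region. Consider any multicommodity dynamical flow network (MDFN) on this MTN with exogenous inflow array $\lambda$, and let $x^*\in\mathcal F$ be its unique free-flow equilibrium point. Define $$\bar\delta=\inf_{x\in\mathcal X\setminus\mathcal F}\|x-x^*\|_1,\qquad \delta^*=\sup\{\delta>0:\ \text{the MDFN is } l_1\text{-nonexpansive on } \mathcal B_\delta(x^* )\}.$$ Then $\bar\delta>0$, $x^*$ is asymptotically stable, and $$\mathcal B_{\bar\delta}(x^* )\subseteq\mathcal B_{\delta^*}(x^* )\subseteq\mathcal A(x^* ).$$
   Context: **Network.** $\mathcal G=(\mathcal V,\mathcal E)$ is a nonempty finite directed multigraph; each link (cell) $i\in\mathcal E$ goes from its tail $\sigma_i\in\mathcal V$ to its head $\tau_i\in\mathcal V\setminus\{\sigma_i\}$. A special node $w\in\mathcal V$ represents the external world. On-ramps: $\mathcal R=\{i\in\mathcal E:\sigma_i=w\}$; off-ramps: $\mathcal S=\{i\in\mathcal E:\tau_i=w\}$; adjacent pairs: $\mathcal A=\{(i,j)\in\mathcal E\times\mathcal E:\tau_i=\sigma_j\ne w\}$. $\mathcal K$ is a nonempty finite set of commodities. **MTN.** A multi-commodity transportation network (MTN) consists of $\mathcal G$, $\mathcal K$ and the following data. - For each $i\in\mathcal E\setminus\mathcal R$, a supply function $s_i:\mathbb R_+\to\mathbb R_+$ that is Lipschitz continuous, with $s_i(0)>0$ and $s_i(\xi)\le s_i(\eta)$ for all $\xi\ge\eta\ge0$.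 - For each $i\in\mathcal E$, $k\in\mathcal K$, a demand function $d_i^{(k)}:\mathbb R_+\to\mathbb R_+$ that is differentiable, with $d_i^{(k)}(0)=0$ and $(d_i^{(k)})'(\xi)>0$ for all $\xi\ge0$. - For each $k\in\mathcal K$, a routing matrix $R^{(k)}\in\mathbb R_+^{\mathcal E\times\mathcal E}$ with $R^{(k)}_{ij}=0$ for $(i,j)\notin\mathcal A$; $\sum_{j}R^{(k)}_{ij}=1$ for $i\in\mathcal E\setminus\mathcal S$ and $=0$ for $i\in\mathcal S$; and such that for every $i_0\in\mathcal E$ there are $l\ge0$ and $(i_1,\dots,i_l)\in\mathcal E^l$ with $i_l\in\mathcal S$ and $\prod_{h=1}^lR^{(k)}_{i_{h-1}i_h}>0$ (the empty product is $1$). Consequently $I-R^{(k)}$ is invertible with nonnegative inverse. **MDFN.** The state space is $\mathcal X=\mathbb R_+^{\mathcal E\times\mathcal K}$, with states $x=(x_i^{(k)})$. An exogenous inflow array is $\lambda=(\lambda_i^{(k)})\in\mathbb R_+^{\mathcal E\times\mathcal K}$ with $\lambda_i^{(k)}=0$ for $i\in\mathcal E\setminus\mathcal R$. The free-flow region is $$\mathcal F=\Big\{x\in\mathcal X:\ \sum_{k\in\mathcal K}\sum_{j\in\mathcal E}R^{(k)}_{ji}d_j^{(k)}(x_j^{(k)})<s_i\Big(\sum_{k\in\mathcal K}x_i^{(k)}\Big)\ \ \forall i\in\mathcal E\setminus\mathcal R\Big\}.$$ Given an MTN and $\lambda$, a multicommodity dynamical flow network (MDFN) is a dynamical system on $\mathcal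 X$ $$\dot x_i^{(k)}=\lambda_i^{(k)}+\sum_{j\in\mathcal E}f_{ji}^{(k)}(x)-z_i^{(k)}(x),\qquad i\in\mathcal E,\ k\in\mathcal K,$$ where $f_{ij}^{(k)}:\mathcal X\to\mathbb R_+$, and $z_i^{(k)}(x)=\sum_jf_{ij}^{(k)}(x)$ if $i\in\mathcal E\setminus\mathcal S$, $z_i^{(k)}(x)=d_i^{(k)}(x_i^{(k)})$ if $i\in\mathcal S$, such that for all $x\in\mathcal X$: - $f_{ij}^{(k)}(x)\le R_{ij}^{(k)}d_i^{(k)}(x_i^{(k)})$ for all $i,j\in\mathcal E$, $k\in\mathcal K$; - $\sum_k\sum_jf_{ji}^{(k)}(x)\le s_i(\sum_kx_i^{(k)})$ for all $i\in\mathcal E\setminus\mathcal R$; - if $x\in\mathcal F$, then $f_{ij}^{(k)}(x)=R_{ij}^{(k)}d_i^{(k)}(x_i^{(k)})$ for all $i,j,k$. Well-posedness is standing: for every $\bar x\in\mathcal X$ there is a unique solution with $x(0)=\bar x$, defined for all $t\ge0$ and staying in $\mathcal X$; it is denoted $\varphi(t,\bar x)$. **Stability region.** For $i\in\mathcal E\setminus\mathcal R$, the capacity region is $\mathcal C_i=\{\zeta\in\mathbb R_+^{\mathcal K}:\sum_k\zeta_k<s_i(\sum_k(d_i^{(k)})^{-1}(\zeta_k))\}$, where membership includes that each $\zeta_k$ lies in the range of $d_i^{(k)}$. The stability region $\Lambda$ is the set of exogenous inflow arrays $\lambda$ such that $\big(((I-(R^{(k)})^\top)^{-1}\lambda^{(k)})_i\big)_{k\in\mathcal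 K}\in\mathcal C_i$ for all $i\in\mathcal E\setminus\mathcal R$, where $\lambda^{(k)}=(\lambda_i^{(k)})_{i\in\mathcal E}$. **Equilibria and stability.** For $\delta>0$, $\mathcal B_\delta(x^* )=\{x\in\mathcal X:\|x-x^*\|_1<\delta\}$, with $\mathcal B_{+\infty}(x^* )=\mathcal X$; $\inf\emptyset=+\infty$. An equilibrium point is $x^*\in\mathcal X$ with $\varphi(t,x^* )=x^*$ for all $t\ge0$; it is a free-flow equilibrium point if $x^*\in\mathcal F$. It is stable if for every $\varepsilon>0$ there is $\delta>0$ such that $x\in\mathcal B_\delta(x^* )$ implies $\varphi(t,x)\in\mathcal B_\varepsilon(x^* )$ for all $t\ge0$. Its region of attraction is $\mathcal A(x^* )=\{x\in\mathcal X:\varphi(t,x)\to x^*\text{ as }t\to+\infty\}$. It is asymptotically stable if it is stable and $\mathcal B_\delta(x^* )\subseteq\mathcal A(x^* )$ for some $\delta>0$. **Nonexpansiveness.** The MDFN is $l_1$-nonexpansive in a region $\mathcal D\subseteq\mathcal X$ if for all $x,y\in\mathcal D$ and $T\ge0$ such that $\varphi(s,x),\varphi(s,y)\in\mathcal D$ for all $0\le s\le T$, one has $\|\varphi(t,y)-\varphi(t,x)\|_1\le\|y-x\|_1$ for all $0\le t\le T$. *)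

theory Defs
  imports "HOL-Analysis.Analysis"
begin

text \<open>
  The sets of nodes, links and commodities are the universes of the finite types
  \<open>'v\<close>, \<open>'e\<close>, \<open>'k\<close>. All real functions below are total; those whose mathematical domain is
  the set of nonnegative reals are only ever constrained and evaluated there, and the supply
  function of an on-ramp is a dummy.
\<close>

record ('v, 'e::finite, 'k) transport_net =
  tail :: "'e \<Rightarrow> 'v"
  head :: "'e \<Rightarrow> 'v"
  world :: 'v
  supply_fn :: "'e \<Rightarrow> real \<Rightarrow> real"
  demand_fn :: "'e \<Rightarrow> 'k \<Rightarrow> real \<Rightarrow> real"
  routing :: "'k \<Rightarrow> real^'e^'e"

definition on_ramps :: "('v, 'e::finite, 'k) transport_net \<Rightarrow> 'e set" where
  "on_ramps M = {i. tail M i = world M}"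

definition off_ramps :: "('v, 'e::finite, 'k) transport_net \<Rightarrow> 'e set" where
  "off_ramps M = {i. head M i = world M}"

definition adjacent :: "('v, 'e::finite, 'k) transport_net \<Rightarrow> ('e \<times> 'e) set" where
  "adjacent M = {(i, j). head M i = tail M j \<and> head M i \<noteq> world M}"

definition is_supply :: "(real \<Rightarrow> real) \<Rightarrow> bool" where
  "is_supply g \<longleftrightarrow>
     (\<forall>\<xi>\<ge>0. 0 \<le> g \<xi>) \<and> (\<exists>L. L-lipschitz_on {0..} g) \<and> 0 < g 0 \<and>
     (\<forall>\<xi> \<eta>. 0 \<le> \<eta> \<longrightarrow> \<eta> \<le> \<xi> \<longrightarrow> g \<xi> \<le> g \<eta>)"

definition is_demand :: "(real \<Rightarrow> real) \<Rightarrow> bool" where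
  "is_demand g \<longleftrightarrow>
     (\<forall>\<xi>\<ge>0. 0 \<le> g \<xi>) \<and> g 0 = 0 \<and>
     (\<forall>\<xi>\<ge>0. \<exists>D>0. (g has_real_derivative D) (at \<xi> within {0..}))"

text \<open>In the last conjunct, \<open>p 0, \<dots>, p l\<close> is the path from \<open>i\<^sub>0\<close> to an off-ramp.\<close>

definition is_routing :: "('v, 'e::finite, 'k) transport_net \<Rightarrow> real^'e^'e \<Rightarrow> bool" where
  "is_routing M R \<longleftrightarrow>
     (\<forall>i j. 0 \<le> R $ i $ j) \<and>
     (\<forall>i j. (i, j) \<notin> adjacent M \<longrightarrow> R $ i $ j = 0) \<and>
     (\<forall>i. i \<notin> off_ramps M \<longrightarrow> (\<Sum>j\<in>UNIV. R $ i $ j) = 1) \<and>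
     (\<forall>i\<in>off_ramps M. (\<Sum>j\<in>UNIV. R $ i $ j) = 0) \<and>
     (\<forall>i\<^sub>0. \<exists>(l::nat) (p::nat \<Rightarrow> 'e).
        p 0 = i\<^sub>0 \<and> p l \<in> off_ramps M \<and> 0 < (\<Prod>h=1..l. R $ p (h - 1) $ p h))"

definition MTN :: "('v, 'e::finite, 'k) transport_net \<Rightarrow> bool" where
  "MTN M \<longleftrightarrow>
     (\<forall>i. head M i \<noteq> tail M i) \<and>
     (\<forall>i. i \<notin> on_ramps M \<longrightarrow> is_supply (supply_fn M i)) \<and>
     (\<forall>i k. is_demand (demand_fn M i k)) \<and>
     (\<forall>k. is_routing M (routing M k))"

definition state_space :: "(real^'k^'e) set" where
  "state_space = {x. \<forall>i k. 0 \<le> x $ i $ k}"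

definition exogenous_inflow ::
  "('v, 'e::finite, 'k::finite) transport_net \<Rightarrow> real^'k^'e \<Rightarrow> bool" where
  "exogenous_inflow M lam \<longleftrightarrow>
     (\<forall>i k. 0 \<le> lam $ i $ k) \<and> (\<forall>i k. i \<notin> on_ramps M \<longrightarrow> lam $ i $ k = 0)"

definition free_flow_region ::
  "('v, 'e::finite, 'k::finite) transport_net \<Rightarrow> (real^'k^'e) set" where
  "free_flow_region M = {x \<in> state_space. \<forall>i. i \<notin> on_ramps M \<longrightarrow>
     (\<Sum>k\<in>UNIV. \<Sum>j\<in>UNIV. routing M k $ j $ i * demand_fn M j k (x $ j $ k))
       < supply_fn M i (\<Sum>k\<in>UNIV. x $ i $ k)}"

definition capacity_region ::
  "('v, 'e::finite, 'k::finite) transport_net \<Rightarrow> 'e \<Rightarrow> (real^'k) set" where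
  "capacity_region M i = {\<zeta>. (\<forall>k. 0 \<le> \<zeta> $ k \<and> \<zeta> $ k \<in> demand_fn M i k ` {0..}) \<and>
     (\<Sum>k\<in>UNIV. \<zeta> $ k) < supply_fn M i (\<Sum>k\<in>UNIV. inv_into {0..} (demand_fn M i k) (\<zeta> $ k))}"

definition stability_region ::
  "('v, 'e::finite, 'k::finite) transport_net \<Rightarrow> (real^'k^'e) set" where
  "stability_region M = {lam. exogenous_inflow M lam \<and>
     (\<forall>i. i \<notin> on_ramps M \<longrightarrow>
       (\<chi> k. (matrix_inv (mat 1 - transpose (routing M k)) *v column k lam) $ i)
         \<in> capacity_region M i)}"

text \<open>\<open>f i j k x\<close> is the flow of commodity \<open>k\<close> from link \<open>i\<close> to link \<open>j\<close> in state \<open>x\<close>.\<close>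

type_synonym ('e, 'k) flows = "'e \<Rightarrow> 'e \<Rightarrow> 'k \<Rightarrow> real^'k^'e \<Rightarrow> real"

definition outflow ::
  "('v, 'e::finite, 'k::finite) transport_net \<Rightarrow> ('e, 'k) flows
     \<Rightarrow> 'e \<Rightarrow> 'k \<Rightarrow> real^'k^'e \<Rightarrow> real" where
  "outflow M f i k x =
     (if i \<in> off_ramps M then demand_fn M i k (x $ i $ k) else (\<Sum>j\<in>UNIV. f i j k x))"

definition vector_field ::
  "('v, 'e::finite, 'k::finite) transport_net \<Rightarrow> real^'k^'e \<Rightarrow> ('e, 'k) flows
     \<Rightarrow> real^'k^'e \<Rightarrow> real^'k^'e" where
  "vector_field M lam f x =
     (\<chi> i k. lam $ i $ k + (\<Sum>j\<in>UNIV. f j i k x) - outflow M f i k x)"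

definition is_solution ::
  "('v, 'e::finite, 'k::finite) transport_net \<Rightarrow> real^'k^'e \<Rightarrow> ('e, 'k) flows
     \<Rightarrow> real^'k^'e \<Rightarrow> (real \<Rightarrow> real^'k^'e) \<Rightarrow> bool" where
  "is_solution M lam f x0 u \<longleftrightarrow> u 0 = x0 \<and>
     (\<forall>t\<ge>0. u t \<in> state_space \<and>
       (u has_vector_derivative vector_field M lam f (u t)) (at t within {0..}))"

definition well_posed ::
  "('v, 'e::finite, 'k::finite) transport_net \<Rightarrow> real^'k^'e \<Rightarrow> ('e, 'k) flows \<Rightarrow> bool" where
  "well_posed M lam f \<longleftrightarrow> (\<forall>x0\<in>state_space. \<exists>u. is_solution M lam f x0 u \<and>
     (\<forall>v. is_solution M lam f x0 v \<longrightarrow> (\<forall>t\<ge>0. v t = u t)))"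

definition MDFN ::
  "('v, 'e::finite, 'k::finite) transport_net \<Rightarrow> real^'k^'e \<Rightarrow> ('e, 'k) flows \<Rightarrow> bool" where
  "MDFN M lam f \<longleftrightarrow>
     exogenous_inflow M lam \<and>
     (\<forall>x\<in>state_space. \<forall>i j k.
        0 \<le> f i j k x \<and> f i j k x \<le> routing M k $ i $ j * demand_fn M i k (x $ i $ k)) \<and>
     (\<forall>x\<in>state_space. \<forall>i. i \<notin> on_ramps M \<longrightarrow>
        (\<Sum>k\<in>UNIV. \<Sum>j\<in>UNIV. f j i k x) \<le> supply_fn M i (\<Sum>k\<in>UNIV. x $ i $ k)) \<and>
     (\<forall>x\<in>free_flow_region M. \<forall>i j k.
        f i j k x = routing M k $ i $ j * demand_fn M i k (x $ i $ k)) \<and>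
     well_posed M lam f"

text \<open>
  The flow map \<open>\<phi>(t, x)\<close>, for \<open>t \<ge> 0\<close> and \<open>x\<close> in the state space. Solutions are unique only on
  \<open>{0..}\<close>, since their values at negative times are arbitrary; the choice is thus immaterial.
\<close>

definition flow ::
  "('v, 'e::finite, 'k::finite) transport_net \<Rightarrow> real^'k^'e \<Rightarrow> ('e, 'k) flows
     \<Rightarrow> real \<Rightarrow> real^'k^'e \<Rightarrow> real^'k^'e" where
  "flow M lam f t x = (SOME u. is_solution M lam f x u) t"

definition l1_norm :: "real^'k^'e \<Rightarrow> real" where
  "l1_norm x = (\<Sum>i\<in>UNIV. \<Sum>k\<in>UNIV. \<bar>x $ i $ k\<bar>)"

definition l1_ball :: "real^'k^'e \<Rightarrow> ereal \<Rightarrow> (real^'k^'e) set" where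
  "l1_ball c \<delta> = {x \<in> state_space. ereal (l1_norm (x - c)) < \<delta>}"

text \<open>
  The notions below are stated for an arbitrary flow map \<open>\<phi>\<close> on the state space.
\<close>

type_synonym ('e, 'k) flow_map = "real \<Rightarrow> real^'k^'e \<Rightarrow> real^'k^'e"

definition equilibrium :: "('e::finite, 'k::finite) flow_map \<Rightarrow> real^'k^'e \<Rightarrow> bool" where
  "equilibrium \<phi> c \<longleftrightarrow> c \<in> state_space \<and> (\<forall>t\<ge>0. \<phi> t c = c)"

definition stable :: "('e::finite, 'k::finite) flow_map \<Rightarrow> real^'k^'e \<Rightarrow> bool" where
  "stable \<phi> c \<longleftrightarrow> (\<forall>\<epsilon>::real. \<epsilon> > 0 \<longrightarrow> (\<exists>\<delta>::real. \<delta> > 0 \<and>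
     (\<forall>x \<in> l1_ball c \<delta>. \<forall>t\<ge>0. \<phi> t x \<in> l1_ball c \<epsilon>)))"

definition region_of_attraction ::
  "('e::finite, 'k::finite) flow_map \<Rightarrow> real^'k^'e \<Rightarrow> (real^'k^'e) set" where
  "region_of_attraction \<phi> c = {x \<in> state_space. ((\<lambda>t. \<phi> t x) \<longlongrightarrow> c) at_top}"

definition asymptotically_stable ::
  "('e::finite, 'k::finite) flow_map \<Rightarrow> real^'k^'e \<Rightarrow> bool" where
  "asymptotically_stable \<phi> c \<longleftrightarrow>
     stable \<phi> c \<and> (\<exists>\<delta>::real. \<delta> > 0 \<and> l1_ball c \<delta> \<subseteq> region_of_attraction \<phi> c)"

definition l1_nonexpansive_on ::
  "('e::finite, 'k::finite) flow_map \<Rightarrow> (real^'k^'e) set \<Rightarrow> bool" where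
  "l1_nonexpansive_on \<phi> D \<longleftrightarrow>
     (\<forall>x\<in>D. \<forall>y\<in>D. \<forall>T\<ge>0. (\<forall>s\<in>{0..T}. \<phi> s x \<in> D \<and> \<phi> s y \<in> D) \<longrightarrow>
        (\<forall>t\<in>{0..T}. l1_norm (\<phi> t y - \<phi> t x) \<le> l1_norm (y - x)))"

end

theory Submission
  imports Defs
begin

text \<open>
  In the free-flow region the dynamics is the cooperative system
  \<open>x\<^sub>i' = \<lambda>\<^sub>i + (\<Sum>j. R\<^sub>j\<^sub>i d\<^sub>j(x\<^sub>j)) - d\<^sub>i(x\<^sub>i)\<close>, separately for each commodity. For two trajectories in
  this region, the difference of the demands of a cell has the sign of the difference of its
  densities, so the outflow of the cell reduces the \<open>l\<^sub>1\<close> distance at the rate of this demand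
  difference, and entering the downstream cells it adds at most as much again, because the rows of
  \<open>R\<close> have sums at most \<open>1\<close>. Hence the \<open>l\<^sub>1\<close> distance does not grow
  (\<open>free_flow_nonexpansive\<close>). The free-flow region is relatively open, so the distance \<open>\<delta>bar\<close> of \<open>xs\<close> from its complement is positive, and the open ball of radius \<open>\<delta>bar\<close> lies in it.
  This yields the first inclusion, and stability as well.

  Attraction has a local and a global part. Locally, the unit weights are replaced by weights \<open>w\<close>
  with \<open>R w < w\<close>. They exist because every cell is connected to an off-ramp
  (\<open>routing_strict_weights\<close>), and they turn the computation above into a strict one: as demands have
  positive derivatives, the weighted distance from \<open>xs\<close> decays at a rate proportional to
  itself as long as the trajectory is close to \<open>xs\<close> (\<open>local_halving\<close>). Globally, on a ball around
  \<open>xs\<close> on which the flow is nonexpansive, this local contraction is transported outwards: a point on the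
  segment from \<open>xs\<close> to \<open>p\<close> that is close to \<open>xs\<close> gets closer, the rest of the segment does not get
  longer, so \<open>p\<close> comes closer by a definite amount (\<open>distance_decrease\<close>). Iterating, all
  trajectories from the ball converge (\<open>ball_attracted\<close>). This step uses only that the flow is a
  semiflow, and it applies although the vector field may be discontinuous outside the free-flow
  region.
\<close>

section \<open>One-sided growth rates\<close>

text \<open>
  The upper right Dini derivative of \<open>g\<close> at \<open>t\<close> is at most \<open>c\<close>. A weighted \<open>l\<^sub>1\<close> distance of two
  trajectories need not be differentiable where a coordinate of the difference vanishes, and the
  formulation with \<open>e\<close> avoids upper limits in the extended reals.
\<close>

definition right_slope_le :: "(real \<Rightarrow> real) \<Rightarrow> real \<Rightarrow> real \<Rightarrow> bool" where
  "right_slope_le g t c \<longleftrightarrow> (\<forall>e>0. \<forall>\<^sub>F s in at_right t. g s \<le> g t + (s - t) * (c + e))"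

lemma right_slope_le_mono:
  assumes "right_slope_le g t c" "c \<le> c'"
  shows "right_slope_le g t c'"
  unfolding right_slope_le_def
proof (intro allI impI)
  fix e :: real assume "e > 0"
  then have "\<forall>\<^sub>F s in at_right t. g s \<le> g t + (s - t) * (c + e)"
    using assms(1) by (auto simp: right_slope_le_def)
  moreover have "\<forall>\<^sub>F s in at_right t. s > t"
    by (simp add: eventually_at_right_less)
  ultimately show "\<forall>\<^sub>F s in at_right t. g s \<le> g t + (s - t) * (c' + e)"
  proof eventually_elim
    case (elim s)
    then have "(s - t) * (c + e) \<le> (s - t) * (c' + e)"
      using assms(2) by (intro mult_left_mono) auto
    with elim show ?case by linarith
  qed
qed

lemma right_slope_le_cmult:
  assumes "right_slope_le g t c" "0 \<le> w"
  shows "right_slope_le (\<lambda>s. w * g s) t (w * c)"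
proof (cases "w = 0")
  case True
  then show ?thesis
    by (auto simp: right_slope_le_def
        intro!: eventually_mono[OF eventually_at_right_less[of t]])
next
  case False
  show ?thesis
    unfolding right_slope_le_def
  proof (intro allI impI)
    fix e :: real assume "e > 0"
    then have "\<forall>\<^sub>F s in at_right t. g s \<le> g t + (s - t) * (c + e / w)"
      using assms False by (auto simp: right_slope_le_def)
    then show "\<forall>\<^sub>F s in at_right t. w * g s \<le> w * g t + (s - t) * (w * c + e)"
    proof eventually_elim
      case (elim s)
      then have "w * g s \<le> w * (g t + (s - t) * (c + e / w))"
        using assms(2) by (rule mult_left_mono)
      also have "\<dots> = w * g t + (s - t) * (w * c + e)"
        using False by (simp add: field_simps)
      finally show ?case .
    qed
  qed
qed

lemma right_slope_le_add:
  assumes "right_slope_le g t c" "right_slope_le h t d"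
  shows "right_slope_le (\<lambda>s. g s + h s) t (c + d)"
  unfolding right_slope_le_def
proof (intro allI impI)
  fix e :: real assume "e > 0"
  then have "\<forall>\<^sub>F s in at_right t. g s \<le> g t + (s - t) * (c + e / 2)"
    "\<forall>\<^sub>F s in at_right t. h s \<le> h t + (s - t) * (d + e / 2)"
    using assms by (auto simp: right_slope_le_def)
  then show "\<forall>\<^sub>F s in at_right t. g s + h s \<le> g t + h t + (s - t) * (c + d + e)"
    by eventually_elim (simp add: field_simps)
qed

lemma right_slope_le_sum:
  assumes "finite I" "\<And>i. i \<in> I \<Longrightarrow> right_slope_le (g i) t (c i)"
  shows "right_slope_le (\<lambda>s. \<Sum>i\<in>I. g i s) t (\<Sum>i\<in>I. c i)"
  using assms
proof (induction I rule: finite_induct)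
  case empty
  then show ?case
    by (auto simp: right_slope_le_def
        intro!: eventually_mono[OF eventually_at_right_less[of t]])
next
  case (insert i I)
  then show ?case by (simp add: right_slope_le_add)
qed

text \<open>
  While \<open>p t \<noteq> 0\<close>, the outflow \<open>b\<close> has the sign of \<open>p t\<close> and shrinks \<open>\<bar>p\<bar>\<close> at its full rate;
  the inflow \<open>a\<close> increases \<open>\<bar>p\<bar>\<close> at rate at most \<open>\<bar>a\<bar>\<close>, whatever its sign. At a zero of \<open>p\<close>, where
  \<open>\<bar>p\<bar>\<close> need not be differentiable, \<open>b\<close> vanishes and the same bound survives.
\<close>

lemma right_slope_le_abs:
  fixes p :: "real \<Rightarrow> real"
  assumes der: "(p has_vector_derivative a - b) (at_right t)"
    and sign: "0 \<le> p t * b" and zero: "p t = 0 \<Longrightarrow> b = 0"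
  shows "right_slope_le (\<lambda>s. \<bar>p s\<bar>) t (\<bar>a\<bar> - \<bar>b\<bar>)"
  unfolding right_slope_le_def
proof (intro allI impI)
  fix e :: real assume "e > 0"
  have lim: "((\<lambda>s. (p s - p t) / (s - t)) \<longlongrightarrow> a - b) (at_right t)"
    using der by (simp add: has_real_derivative_iff_has_vector_derivative[symmetric]
        has_field_derivative_iff)
  have quot: "\<forall>\<^sub>F s in at_right t. \<bar>(p s - p t) / (s - t) - (a - b)\<bar> < e"
    using tendstoD[OF lim \<open>e > 0\<close>] by (simp add: dist_real_def)
  have gt: "\<forall>\<^sub>F s in at_right t. s > t"
    by (simp add: eventually_at_right_less)
  have small: "\<forall>\<^sub>F s in at_right t. (s - t) * \<bar>b\<bar> \<le> \<bar>p t\<bar>"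
  proof (cases "b = 0")
    case True
    then show ?thesis by simp
  next
    case False
    have "((\<lambda>s. (s - t) * \<bar>b\<bar>) \<longlongrightarrow> (t - t) * \<bar>b\<bar>) (at_right t)"
      by (intro tendsto_intros)
    moreover have "(t - t) * \<bar>b\<bar> < \<bar>p t\<bar>"
      using False zero by auto
    ultimately have "\<forall>\<^sub>F s in at_right t. (s - t) * \<bar>b\<bar> < \<bar>p t\<bar>"
      by (rule order_tendstoD)
    then show ?thesis by eventually_elim simp
  qed
  from quot gt small
  show "\<forall>\<^sub>F s in at_right t. \<bar>p s\<bar> \<le> \<bar>p t\<bar> + (s - t) * (\<bar>a\<bar> - \<bar>b\<bar> + e)"
  proof eventually_elim
    case (elim s)
    define h where "h = s - t"
    have h: "h > 0" "h * \<bar>b\<bar> \<le> \<bar>p t\<bar>" using elim by (auto simp: h_def)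
    have "\<bar>(p s - p t) / h - (a - b)\<bar> * h \<le> e * h"
      using elim h by (intro mult_right_mono) (auto simp: h_def)
    also have "\<bar>(p s - p t) / h - (a - b)\<bar> * h = \<bar>((p s - p t) / h - (a - b)) * h\<bar>"
      using h by (simp add: abs_mult)
    also have "((p s - p t) / h - (a - b)) * h = p s - (p t - h * b + h * a)"
      using h by (simp add: field_simps)
    finally have A: "\<bar>p s\<bar> \<le> \<bar>p t - h * b\<bar> + \<bar>h * a\<bar> + e * h" by linarith
    have "\<bar>h * b\<bar> \<le> \<bar>p t\<bar>" using h by (simp add: abs_mult)
    moreover have "0 \<le> p t * (h * b)"
      using mult_nonneg_nonneg[of h "p t * b"] h sign by (simp add: mult_ac)
    ultimately have "\<bar>p t - h * b\<bar> = \<bar>p t\<bar> - \<bar>h * b\<bar>"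
      unfolding zero_le_mult_iff[of "p t" "h * b"] by (elim disjE conjE) linarith+
    moreover have "\<bar>h * b\<bar> = h * \<bar>b\<bar>" "\<bar>h * a\<bar> = h * \<bar>a\<bar>"
      using h by (simp_all add: abs_mult)
    ultimately show ?case
      using A unfolding h_def[symmetric] by (simp add: algebra_simps)
  qed
qed

text \<open>
  Mean value inequality. If the line of slope \<open>c + e\<close> through \<open>(a, g a)\<close> were exceeded at \<open>b\<close>,
  there would be a last time at which \<open>g\<close> does not exceed it, and the growth bound at that time
  would keep \<open>g\<close> below the line a little longer.
\<close>

lemma growth_le_of_right_slope_le:
  assumes "a \<le> b" and cont: "continuous_on {a..b} g"
    and slope: "\<And>t. a \<le> t \<Longrightarrow> t < b \<Longrightarrow> right_slope_le g t c"
  shows "g b \<le> g a + c * (b - a)"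
proof (rule field_le_epsilon)
  fix e0 :: real assume "e0 > 0"
  define e where "e = e0 / (b - a + 1)"
  have e: "e > 0" "e * (b - a) \<le> e0"
    using \<open>e0 > 0\<close> \<open>a \<le> b\<close> by (auto simp: e_def field_simps)
  define h where "h s = g s - g a - (c + e) * (s - a)" for s
  have hcont: "continuous_on {a..b} h"
    unfolding h_def by (intro continuous_intros cont)
  have "h b \<le> 0"
  proof (rule ccontr)
    assume hb: "\<not> h b \<le> 0"
    define S where "S = {a..b} \<inter> h -` {..0}"
    have "closed S"
      unfolding S_def by (rule continuous_closed_preimage[OF hcont]) auto
    then have "compact S"
      unfolding S_def by (metis Int_lower1 bounded_closed_interval bounded_subset compact_eq_bounded_closed)
    moreover have "a \<in> S" using \<open>a \<le> b\<close> by (auto simp: S_def h_def)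
    ultimately obtain m where m: "m \<in> S" "\<And>s. s \<in> S \<Longrightarrow> s \<le> m"
      using compact_attains_sup[of S] by blast
    have hm: "a \<le> m" "m \<le> b" "h m \<le> 0" using m by (auto simp: S_def)
    with hb have mb: "m < b" by (metis order_le_less)
    have "\<forall>\<^sub>F s in at_right m. g s \<le> g m + (s - m) * (c + e)"
      using slope[OF hm(1) mb] e by (auto simp: right_slope_le_def)
    moreover have "\<forall>\<^sub>F s in at_right m. s \<in> {m<..<b}"
      using mb by (rule eventually_at_right_real)
    ultimately have "\<forall>\<^sub>F s in at_right m. s \<in> {m<..<b} \<and> g s \<le> g m + (s - m) * (c + e)"
      by eventually_elim simp
    then obtain s where s: "m < s" "s < b" "g s \<le> g m + (s - m) * (c + e)"
      using eventually_happens[of _ "at_right m"] by (auto simp: trivial_limit_at_right_real)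
    then have "h s \<le> h m" by (simp add: h_def algebra_simps)
    then have "s \<in> S" using s hm by (auto simp: S_def)
    with m s show False by fastforce
  qed
  then show "g b \<le> g a + c * (b - a) + e0"
    using e by (simp add: h_def algebra_simps)
qed

text \<open>
  \<open>V\<close> decreases, so \<open>V T\<close> is its least value on \<open>{0..T}\<close> and \<open>V\<close> loses at least \<open>\<kappa> * V T\<close> per unit
  time. This bound is weaker than exponential decay, but it makes \<open>V T / V 0\<close> as small as desired,
  uniformly in \<open>V 0\<close>, when \<open>T\<close> is large.
\<close>

lemma decay_of_right_slope_le:
  assumes "0 \<le> T" "0 \<le> \<kappa>" and cont: "continuous_on {0..T} V"
    and nonneg: "\<And>t. 0 \<le> t \<Longrightarrow> 0 \<le> V t"
    and slope: "\<And>t. 0 \<le> t \<Longrightarrow> right_slope_le V t (- \<kappa> * V t)"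
  shows "V T * (1 + \<kappa> * T) \<le> V 0"
proof -
  have anti: "V T \<le> V t" if "0 \<le> t" "t \<le> T" for t
  proof -
    have "V T \<le> V t + 0 * (T - t)"
    proof (rule growth_le_of_right_slope_le)
      show "continuous_on {t..T} V" by (rule continuous_on_subset[OF cont]) (use that in auto)
      show "right_slope_le V s 0" if "t \<le> s" "s < T" for s
        by (rule right_slope_le_mono[OF slope]) (use \<open>0 \<le> t\<close> that nonneg assms in auto)
    qed (use that in auto)
    then show ?thesis by simp
  qed
  have "V T \<le> V 0 + (- \<kappa> * V T) * (T - 0)"
  proof (rule growth_le_of_right_slope_le[OF \<open>0 \<le> T\<close> cont])
    show "right_slope_le V t (- \<kappa> * V T)" if "0 \<le> t" "t < T" for t
      by (rule right_slope_le_mono[OF slope[OF that(1)]])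
        (use anti that assms in \<open>auto intro!: mult_left_mono\<close>)
  qed
  then show ?thesis by (simp add: algebra_simps)
qed

section \<open>The \<open>l\<^sub>1\<close> norm\<close>

lemma l1_norm_nonneg: "0 \<le> l1_norm x"
  by (simp add: l1_norm_def sum_nonneg)

lemma l1_norm_component_le: "\<bar>x $ i $ k\<bar> \<le> l1_norm x"
proof -
  have "\<bar>x $ i $ k\<bar> \<le> (\<Sum>k\<in>UNIV. \<bar>x $ i $ k\<bar>)"
    by (rule member_le_sum) auto
  also have "\<dots> \<le> l1_norm x"
    unfolding l1_norm_def
    by (rule member_le_sum[where f = "\<lambda>i. \<Sum>k\<in>UNIV. \<bar>x $ i $ k\<bar>"]) (auto simp: sum_nonneg)
  finally show ?thesis .
qed

lemma norm_le_l1_norm: "norm x \<le> l1_norm x"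
proof -
  have "norm x \<le> (\<Sum>i\<in>UNIV. norm (x $ i))"
    unfolding norm_vec_def by (rule L2_set_le_sum) auto
  also have "\<dots> \<le> l1_norm x"
    unfolding l1_norm_def by (intro sum_mono norm_le_l1_cart)
  finally show ?thesis .
qed

lemma l1_norm_triangle: "l1_norm (x + y) \<le> l1_norm x + l1_norm y"
  by (auto simp: l1_norm_def sum.distrib[symmetric] intro!: sum_mono abs_triangle_ineq)

lemma l1_norm_scaleR: "l1_norm (c *\<^sub>R x) = \<bar>c\<bar> * l1_norm x"
  by (simp add: l1_norm_def abs_mult sum_distrib_left)

lemma continuous_on_l1_norm:
  "continuous_on A g \<Longrightarrow> continuous_on A (\<lambda>t. l1_norm (g t))"
  unfolding l1_norm_def by (intro continuous_intros)

lemma mem_l1_ball: "x \<in> l1_ball c (ereal d) \<longleftrightarrow> x \<in> state_space \<and> l1_norm (x - c) < d"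
  by (simp add: l1_ball_def)

section \<open>Nonexpansive semiflows\<close>

definition semiflow :: "('e::finite, 'k::finite) flow_map \<Rightarrow> bool" where
  "semiflow \<phi> \<longleftrightarrow> (\<forall>x\<in>state_space. \<phi> 0 x = x \<and> continuous_on {0..} (\<lambda>t. \<phi> t x) \<and>
     (\<forall>t\<ge>0. \<phi> t x \<in> state_space) \<and> (\<forall>s\<ge>0. \<forall>t\<ge>0. \<phi> (s + t) x = \<phi> t (\<phi> s x)))"

text \<open>
  Nonexpansiveness only speaks about trajectories that remain in the ball, so invariance is proved
  first: a trajectory that left the ball would, by the intermediate value theorem, attain a
  distance from the centre that is larger than its initial one before it leaves.
\<close>

lemma nonexpansive_ball_invariant:
  assumes "semiflow \<phi>" "equilibrium \<phi> c" "l1_nonexpansive_on \<phi> (l1_ball c (ereal \<delta>))"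
    and x: "x \<in> l1_ball c (ereal \<delta>)" and "0 \<le> t"
  shows "\<phi> t x \<in> l1_ball c (ereal \<delta>)"
proof (rule ccontr)
  assume out: "\<phi> t x \<notin> l1_ball c (ereal \<delta>)"
  define N where "N s = l1_norm (\<phi> s x - c)" for s
  have xs: "x \<in> state_space" and N0: "N 0 < \<delta>"
    using x assms(1) by (auto simp: mem_l1_ball N_def semiflow_def)
  have inX: "\<phi> s x \<in> state_space" if "0 \<le> s" for s
    using assms(1) xs that by (auto simp: semiflow_def)
  have Nt: "\<delta> \<le> N t" using out inX[OF \<open>0 \<le> t\<close>] by (auto simp: mem_l1_ball N_def)
  have c0: "l1_norm (c - c) < \<delta>"
    using N0 l1_norm_nonneg[of "\<phi> 0 x - c"] by (simp add: N_def l1_norm_def)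
  have contN: "continuous_on {0..} N"
    unfolding N_def using assms(1) xs
    by (intro continuous_on_l1_norm continuous_intros) (auto simp: semiflow_def)
  define S where "S = {0..t} \<inter> N -` {\<delta>..}"
  have "continuous_on {0..t} N" by (rule continuous_on_subset[OF contN]) auto
  then have "closed S"
    unfolding S_def by (rule continuous_closed_preimage) auto
  then have "compact S"
    unfolding S_def by (metis Int_lower1 bounded_closed_interval bounded_subset compact_eq_bounded_closed)
  moreover have "t \<in> S" using Nt \<open>0 \<le> t\<close> by (auto simp: S_def)
  ultimately obtain m where m: "m \<in> S" "\<And>s. s \<in> S \<Longrightarrow> m \<le> s"
    using compact_attains_inf[of S] by blast
  have m0: "0 \<le> m" "m \<le> t" "\<delta> \<le> N m" using m by (auto simp: S_def)
  have "\<exists>s\<ge>0. s \<le> m \<and> N s = (N 0 + \<delta>) / 2"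
    using N0 m0 by (intro IVT' continuous_on_subset[OF contN]) auto
  then obtain s where s: "0 \<le> s" "s \<le> m" "N s = (N 0 + \<delta>) / 2" by blast
  \<comment> \<open>up to time \<open>s\<close> the trajectory is in the ball, yet at \<open>s\<close> its distance exceeds the initial one\<close>
  have "s < m" using s m0 N0 by (cases "s = m") auto
  have "\<phi> r x \<in> l1_ball c (ereal \<delta>) \<and> \<phi> r c \<in> l1_ball c (ereal \<delta>)" if "r \<in> {0..s}" for r
  proof -
    have "r \<notin> S" using m(2)[of r] that \<open>s < m\<close> by auto
    then have "N r < \<delta>" using that \<open>s < m\<close> m0 by (auto simp: S_def)
    then show ?thesis
      using that inX[of r] assms(2) c0 by (auto simp: mem_l1_ball N_def equilibrium_def)
  qed
  moreover have "c \<in> l1_ball c (ereal \<delta>)"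
    using assms(2) c0 by (auto simp: mem_l1_ball equilibrium_def)
  ultimately have "l1_norm (\<phi> s x - \<phi> s c) \<le> l1_norm (x - c)"
    using assms(3) x s(1) unfolding l1_nonexpansive_on_def by (meson atLeastAtMost_iff order_refl)
  then have "N s \<le> N 0"
    using assms(1,2) xs s by (auto simp: N_def equilibrium_def semiflow_def)
  then show False using s N0 by simp
qed

lemma nonexpansive_on_ball:
  assumes "semiflow \<phi>" "equilibrium \<phi> c" "l1_nonexpansive_on \<phi> (l1_ball c (ereal \<delta>))"
    and "x \<in> l1_ball c (ereal \<delta>)" "y \<in> l1_ball c (ereal \<delta>)" "0 \<le> t"
  shows "l1_norm (\<phi> t y - \<phi> t x) \<le> l1_norm (y - x)"
proof -
  have "\<forall>s\<in>{0..t}. \<phi> s x \<in> l1_ball c (ereal \<delta>) \<and> \<phi> s y \<in> l1_ball c (ereal \<delta>)"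
    using nonexpansive_ball_invariant[OF assms(1-3)] assms(4,5) by auto
  then show ?thesis
    using assms(3-6) unfolding l1_nonexpansive_on_def by (meson atLeastAtMost_iff order_refl)
qed

lemma distance_to_equilibrium_le:
  assumes "semiflow \<phi>" "equilibrium \<phi> c" "l1_nonexpansive_on \<phi> (l1_ball c (ereal \<delta>))"
    and x: "x \<in> l1_ball c (ereal \<delta>)" and "0 \<le> t"
  shows "l1_norm (\<phi> t x - c) \<le> l1_norm (x - c)"
proof -
  have "l1_norm (c - c) < \<delta>"
    using x l1_norm_nonneg[of "x - c"] by (simp add: mem_l1_ball l1_norm_def)
  then have "c \<in> l1_ball c (ereal \<delta>)"
    using assms(2) by (auto simp: mem_l1_ball equilibrium_def)
  then have "l1_norm (\<phi> t x - \<phi> t c) \<le> l1_norm (x - c)"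
    using nonexpansive_on_ball[OF assms(1-3)] assms(4,5) by blast
  then show ?thesis using assms(2,5) by (simp add: equilibrium_def)
qed

lemma stable_of_nonexpansive:
  assumes "semiflow \<phi>" "equilibrium \<phi> c" "l1_nonexpansive_on \<phi> (l1_ball c (ereal \<delta>))" "0 < \<delta>"
  shows "stable \<phi> c"
  unfolding stable_def
proof (intro allI impI)
  fix e :: real assume "ereal e > 0"
  have "\<phi> t x \<in> l1_ball c (ereal e)" if x: "x \<in> l1_ball c (ereal (min e \<delta>))" and t: "0 \<le> t" for x t
  proof -
    have x': "x \<in> l1_ball c (ereal \<delta>)" and xe: "l1_norm (x - c) < e"
      using x by (auto simp: l1_ball_def)
    from nonexpansive_ball_invariant[OF assms(1-3) x' t]
      distance_to_equilibrium_le[OF assms(1-3) x' t] xe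
    show ?thesis by (auto simp: mem_l1_ball)
  qed
  moreover have "0 < ereal (min e \<delta>)" using \<open>ereal e > 0\<close> \<open>0 < \<delta>\<close> by simp
  ultimately show "\<exists>d. ereal d > 0 \<and> (\<forall>x\<in>l1_ball c (ereal d). \<forall>t\<ge>0. \<phi> t x \<in> l1_ball c (ereal e))"
    by blast
qed

text \<open>
  Halving near the centre propagates to the whole ball. Let \<open>q\<close> be the point of the segment from
  \<open>c\<close> to \<open>p\<close> at distance \<open>min \<parallel>p - c\<parallel> r\<close> from \<open>c\<close>. During time \<open>T\<close> the distance of \<open>q\<close> from \<open>c\<close> is
  halved and that of \<open>p\<close> from \<open>q\<close> does not grow; as the two distances add up to \<open>\<parallel>p - c\<parallel>\<close>, the
  triangle inequality gives a definite decrease.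
\<close>

lemma distance_decrease:
  assumes sf: "semiflow \<phi>" and eq: "equilibrium \<phi> c"
    and ne: "l1_nonexpansive_on \<phi> (l1_ball c (ereal \<delta>))"
    and "0 < r" "0 \<le> T"
    and halving: "\<And>q. q \<in> state_space \<Longrightarrow> (\<And>t. 0 \<le> t \<Longrightarrow> l1_norm (\<phi> t q - c) \<le> r) \<Longrightarrow>
       l1_norm (\<phi> T q - c) \<le> l1_norm (q - c) / 2"
    and p: "p \<in> l1_ball c (ereal \<delta>)"
  shows "l1_norm (\<phi> T p - c) \<le> l1_norm (p - c) - min (l1_norm (p - c)) r / 2"
proof (cases "l1_norm (p - c) = 0")
  case True
  then show ?thesis
    using distance_to_equilibrium_le[OF sf eq ne p \<open>0 \<le> T\<close>] \<open>0 < r\<close> by simp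
next
  case False
  define n where "n = l1_norm (p - c)"
  define a where "a = min n r / n"
  define q where "q = c + a *\<^sub>R (p - c)"
  have n: "n > 0" using False l1_norm_nonneg[of "p - c"] by (simp add: n_def)
  have a: "0 \<le> a" "a \<le> 1" "a * n = min n r"
    using n \<open>0 < r\<close> by (auto simp: a_def field_simps)
  have qX: "q \<in> state_space"
    unfolding state_space_def
  proof (clarify)
    fix i k
    have "0 \<le> (1 - a) * (c $ i $ k) + a * (p $ i $ k)"
      using a p eq by (intro add_nonneg_nonneg mult_nonneg_nonneg)
        (auto simp: mem_l1_ball state_space_def equilibrium_def)
    then show "0 \<le> q $ i $ k" by (simp add: q_def algebra_simps)
  qed
  have qc: "l1_norm (q - c) = min n r"
    using a by (simp add: q_def l1_norm_scaleR n_def)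
  have "p - q = (1 - a) *\<^sub>R (p - c)" by (simp add: q_def algebra_simps)
  then have pq: "l1_norm (p - q) = n - min n r"
    using a by (simp add: l1_norm_scaleR n_def[symmetric] left_diff_distrib)
  have qb: "q \<in> l1_ball c (ereal \<delta>)"
    using qX qc p by (auto simp: mem_l1_ball n_def)
  have "l1_norm (\<phi> T q - c) \<le> l1_norm (q - c) / 2"
  proof (rule halving[OF qX])
    fix t :: real assume "0 \<le> t"
    from distance_to_equilibrium_le[OF sf eq ne qb this] qc
    show "l1_norm (\<phi> t q - c) \<le> r" by simp
  qed
  moreover have "l1_norm (\<phi> T p - \<phi> T q) \<le> l1_norm (p - q)"
    by (rule nonexpansive_on_ball[OF sf eq ne qb p \<open>0 \<le> T\<close>])
  moreover have "l1_norm (\<phi> T p - c) \<le> l1_norm (\<phi> T p - \<phi> T q) + l1_norm (\<phi> T q - c)"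
    using l1_norm_triangle[of "\<phi> T p - \<phi> T q" "\<phi> T q - c"] by simp
  ultimately show ?thesis unfolding qc pq n_def[symmetric] by linarith
qed

text \<open>
  A trajectory that stays at distance at least \<open>e\<close> from \<open>c\<close> would lose \<open>min e r / 2\<close> of its distance in
  every period \<open>T\<close>, and the distance would become negative. So it gets arbitrarily close to
  \<open>c\<close>, and it remains close since the distance is nonincreasing.
\<close>

lemma ball_attracted:
  assumes sf: "semiflow \<phi>" and eq: "equilibrium \<phi> c"
    and ne: "l1_nonexpansive_on \<phi> (l1_ball c (ereal \<delta>))"
    and "0 < r" "0 \<le> T"
    and halving: "\<And>q. q \<in> state_space \<Longrightarrow> (\<And>t. 0 \<le> t \<Longrightarrow> l1_norm (\<phi> t q - c) \<le> r) \<Longrightarrow>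
       l1_norm (\<phi> T q - c) \<le> l1_norm (q - c) / 2"
    and x: "x \<in> l1_ball c (ereal \<delta>)"
  shows "x \<in> region_of_attraction \<phi> c"
proof -
  have xX: "x \<in> state_space" using x by (simp add: mem_l1_ball)
  define N where "N t = l1_norm (\<phi> t x - c)" for t
  have anti: "N (s + t) \<le> N s" if "0 \<le> s" "0 \<le> t" for s t
    using distance_to_equilibrium_le[OF sf eq ne nonexpansive_ball_invariant[OF sf eq ne x that(1)] that(2)]
      sf xX that by (simp add: N_def semiflow_def)
  have dec: "N (s + T) \<le> N s - min (N s) r / 2" if "0 \<le> s" for s
    using distance_decrease[OF sf eq ne \<open>0 < r\<close> \<open>0 \<le> T\<close> halving nonexpansive_ball_invariant[OF sf eq ne x that]]
      sf xX that \<open>0 \<le> T\<close> by (simp add: N_def semiflow_def)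
  have reach: "\<exists>t0\<ge>0. N t0 < e" if "e > 0" for e
  proof (rule ccontr)
    assume "\<not> ?thesis"
    then have big: "e \<le> N t" if "0 \<le> t" for t using that by force
    define m where "m = min e r / 2"
    have "m > 0" using \<open>e > 0\<close> \<open>0 < r\<close> by (simp add: m_def)
    have bound: "N (real n * T) \<le> N 0 - real n * m" for n
    proof (induction n)
      case 0
      then show ?case by simp
    next
      case (Suc n)
      have "N (real (Suc n) * T) = N (real n * T + T)" by (simp add: algebra_simps)
      also have "\<dots> \<le> N (real n * T) - min (N (real n * T)) r / 2"
        by (rule dec) (use \<open>0 \<le> T\<close> in simp)
      also have "\<dots> \<le> N (real n * T) - m"
        using big[of "real n * T"] \<open>0 \<le> T\<close> by (simp add: m_def min_def)
      also have "\<dots> \<le> N 0 - real (Suc n) * m" using Suc by (simp add: algebra_simps)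
      finally show ?case .
    qed
    obtain n where "N 0 < real n * m"
      using reals_Archimedean3[OF \<open>m > 0\<close>] by blast
    with bound[of n] l1_norm_nonneg[of "\<phi> (real n * T) x - c"] show False by (simp add: N_def)
  qed
  have "((\<lambda>t. \<phi> t x) \<longlongrightarrow> c) at_top"
  proof (rule tendstoI)
    fix e :: real assume "e > 0"
    then obtain t0 where t0: "0 \<le> t0" "N t0 < e" using reach by blast
    have "dist (\<phi> t x) c < e" if "t \<ge> t0" for t
    proof -
      have "dist (\<phi> t x) c \<le> N t" by (simp add: dist_norm N_def norm_le_l1_norm)
      also have "N t \<le> N t0" using anti[of t0 "t - t0"] t0 that by simp
      finally show ?thesis using t0 by simp
    qed
    then show "\<forall>\<^sub>F t in at_top. dist (\<phi> t x) c < e"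
      by (auto simp: eventually_at_top_linorder)
  qed
  then show ?thesis using xX by (simp add: region_of_attraction_def)
qed

section \<open>Demand functions and routing matrices\<close>

lemma demand_continuous_on:
  assumes "is_demand g" shows "continuous_on {0..} g"
  unfolding continuous_on_eq_continuous_within
  using assms by (auto simp: is_demand_def intro: DERIV_continuous)

lemma demand_strict_mono:
  assumes "is_demand g" "0 \<le> a" "a < b" shows "g a < g b"
proof (rule DERIV_pos_imp_increasing_open[OF \<open>a < b\<close>])
  show "continuous_on {a..b} g"
    by (rule continuous_on_subset[OF demand_continuous_on[OF assms(1)]]) (use assms in auto)
  fix x assume x: "a < x" "x < b"
  then have "0 \<le> x" using assms(2) by simp
  then obtain D where D: "D > 0" "(g has_real_derivative D) (at x within {0..})"
    using assms(1) unfolding is_demand_def by blast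
  have "x \<in> interior {0..}" using x assms by auto
  then have "at x within {0..} = at x" by (rule at_within_interior)
  with D show "\<exists>y. (g has_real_derivative y) (at x) \<and> 0 < y" by auto
qed

lemma demand_difference_sign:
  assumes "is_demand g" "0 \<le> a" "0 \<le> b"
  shows "0 \<le> (b - a) * (g b - g a)"
  using demand_strict_mono[OF assms(1), of a b] demand_strict_mono[OF assms(1), of b a] assms
  by (cases a b rule: linorder_cases) (auto simp: zero_le_mult_iff)

lemma demand_local_expansion:
  assumes "is_demand g" "0 \<le> a"
  shows "\<exists>r>0. \<exists>m>0. \<forall>b\<ge>0. \<bar>b - a\<bar> \<le> r \<longrightarrow> m * \<bar>b - a\<bar> \<le> \<bar>g b - g a\<bar>"
proof -
  obtain D where D: "D > 0" "(g has_real_derivative D) (at a within {0..})"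
    using assms by (auto simp: is_demand_def)
  then have "((\<lambda>b. (g b - g a) / (b - a)) \<longlongrightarrow> D) (at a within {0..})"
    by (simp add: has_field_derivative_iff)
  then have "\<forall>\<^sub>F b in at a within {0..}. D / 2 < (g b - g a) / (b - a)"
    by (rule order_tendstoD) (use D in simp)
  then obtain r where r: "r > 0"
    "\<And>b. b \<ge> 0 \<Longrightarrow> b \<noteq> a \<Longrightarrow> dist b a \<le> r \<Longrightarrow> D / 2 < (g b - g a) / (b - a)"
    by (auto simp: eventually_at_le)
  have "D / 2 * \<bar>b - a\<bar> \<le> \<bar>g b - g a\<bar>" if "b \<ge> 0" "\<bar>b - a\<bar> \<le> r" for b
  proof (cases "b = a")
    case False
    then have "D / 2 < (g b - g a) / (b - a)"
      using r(2)[of b] that by (simp add: dist_real_def)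
    then have "D / 2 \<le> \<bar>(g b - g a) / (b - a)\<bar>" by linarith
    then have "D / 2 \<le> \<bar>g b - g a\<bar> / \<bar>b - a\<bar>" by (simp only: abs_divide)
    then show ?thesis using False by (simp add: pos_le_divide_eq)
  qed simp
  with r D show ?thesis by (intro exI[of _ r] conjI exI[of _ "D / 2"]) auto
qed

lemma finite_positive_lower_bound:
  fixes g :: "'a::finite \<Rightarrow> real"
  assumes "\<And>a. 0 < g a"
  shows "\<exists>c>0. \<forall>a. c \<le> g a"
  using assms by (intro exI[of _ "Min (range g)"]) (auto simp: Min_gr_iff)

text \<open>
  Let \<open>d i\<close> be the length of a shortest path of positive entries from \<open>i\<close> to an off-ramp. The weights
  \<open>w i = 1 - \<theta> ^ d i / 2\<close> work if \<open>\<theta>\<close> is smaller than all positive entries of \<open>R\<close>: if \<open>i\<close> is not an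
  off-ramp, then row \<open>i\<close> averages the values \<open>\<theta> ^ d j\<close>, and the contribution of the next cell on
  a shortest path alone already exceeds \<open>\<theta> ^ d i\<close>. At an off-ramp, the row vanishes and \<open>w i > 0\<close>.
\<close>

lemma routing_strict_weights:
  fixes R :: "real^'e^'e"
  assumes R: "is_routing M R"
  shows "\<exists>w::'e \<Rightarrow> real. \<forall>i. 1 / 2 \<le> w i \<and> w i \<le> 1 \<and> (\<Sum>j\<in>UNIV. R $ i $ j * w j) < w i"
proof -
  have nonneg: "0 \<le> R $ i $ j" for i j using R by (simp add: is_routing_def)
  define reach where "reach i l \<longleftrightarrow> (\<exists>p::nat \<Rightarrow> 'e. p 0 = i \<and> p l \<in> off_ramps M \<and>
    (\<forall>h\<in>{1..l}. 0 < R $ p (h - 1) $ p h))" for i l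
  have "\<exists>l. reach i l" for i
  proof -
    obtain l :: nat and p where p: "p 0 = i" "p l \<in> off_ramps M" "0 < (\<Prod>h=1..l. R $ p (h - 1) $ p h)"
      using R unfolding is_routing_def by blast
    have "0 < R $ p (h - 1) $ p h" if "h \<in> {1..l}" for h
      using p(3) that nonneg[of "p (h - 1)" "p h"] by (force simp: less_le prod_zero_iff)
    with p show ?thesis unfolding reach_def by blast
  qed
  define d where "d i = (LEAST l. reach i l)" for i
  have reach_d: "reach i (d i)" for i
    unfolding d_def by (rule LeastI_ex) fact
  have d_le: "d i \<le> l" if "reach i l" for i l
    unfolding d_def by (rule Least_le) fact
  have pos: "0 < (if R $ i $ j = 0 then 1 else R $ i $ j)" for i j
    using nonneg[of i j] by simp
  \<comment> \<open>a positive lower bound for the nonzero entries; the value \<open>1\<close> stands in for the zero ones\<close>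
  obtain \<rho> where \<rho>: "\<rho> > 0" "\<And>i j. \<rho> \<le> (if R $ i $ j = 0 then 1 else R $ i $ j)"
    using finite_positive_lower_bound[of "\<lambda>(i, j). if R $ i $ j = 0 then 1 else R $ i $ j"] pos
    by auto
  \<comment> \<open>\<open>\<theta> < \<rho>\<close> gives the strict inequality, \<open>\<theta> \<le> 1\<close> makes \<open>\<theta> ^ n\<close> antitone in \<open>n\<close>\<close>
  define \<theta> where "\<theta> = min (\<rho> / 2) 1"
  have \<theta>: "0 < \<theta>" "\<theta> \<le> 1" "\<theta> < \<rho>" using \<rho>(1) by (auto simp: \<theta>_def)
  define w where "w i = 1 - \<theta> ^ d i / 2" for i
  have pow: "0 < \<theta> ^ n" "\<theta> ^ n \<le> 1" for n
    using \<theta> by (auto simp: power_le_one)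
  have w: "1 / 2 \<le> w i" "w i \<le> 1" for i
    using pow[of "d i"] by (auto simp: w_def)
  have "(\<Sum>j\<in>UNIV. R $ i $ j * w j) < w i" for i
  proof (cases "i \<in> off_ramps M")
    case True
    then have "(\<Sum>j\<in>UNIV. R $ i $ j) = 0" using R by (simp add: is_routing_def)
    then have "R $ i $ j = 0" for j
      using nonneg by (simp add: sum_nonneg_eq_0_iff)
    then show ?thesis using w(1)[of i] by simp
  next
    case False
    then have row: "(\<Sum>j\<in>UNIV. R $ i $ j) = 1" using R by (simp add: is_routing_def)
    obtain p where p: "p 0 = i" "p (d i) \<in> off_ramps M"
      "\<And>h. h \<in> {1..d i} \<Longrightarrow> 0 < R $ p (h - 1) $ p h"
      using reach_d[of i] unfolding reach_def by blast
    with False obtain n where n: "d i = Suc n" by (cases "d i") auto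
    have R01: "0 < R $ i $ p 1" using p(3)[of 1] p(1) n by simp
    have "reach (p 1) n"
      unfolding reach_def
    proof (intro exI[of _ "\<lambda>h. p (Suc h)"] conjI ballI)
      fix h assume "h \<in> {1..n}"
      then show "0 < R $ p (Suc (h - 1)) $ p (Suc h)" using p(3)[of "Suc h"] n by simp
    qed (use p n in auto)
    then have "d (p 1) \<le> n" by (rule d_le)
    then have "\<theta> ^ n \<le> \<theta> ^ d (p 1)" using \<theta> by (intro power_decreasing) auto
    moreover have "\<rho> \<le> R $ i $ p 1" using \<rho>(2)[of i "p 1"] R01 by simp
    ultimately have "\<rho> * \<theta> ^ n \<le> R $ i $ p 1 * \<theta> ^ d (p 1)"
      using \<rho>(1) pow[of n] R01 by (intro mult_mono) auto
    also have "\<dots> \<le> (\<Sum>j\<in>UNIV. R $ i $ j * \<theta> ^ d j)"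
      by (rule member_le_sum[where f = "\<lambda>j. R $ i $ j * \<theta> ^ d j"])
        (use nonneg pow in \<open>auto simp: less_imp_le\<close>)
    finally have "\<rho> * \<theta> ^ n \<le> (\<Sum>j\<in>UNIV. R $ i $ j * \<theta> ^ d j)" .
    moreover have "\<theta> ^ d i < \<rho> * \<theta> ^ n" using n \<theta> pow[of n] by simp
    moreover have "(\<Sum>j\<in>UNIV. R $ i $ j * w j) = 1 - (\<Sum>j\<in>UNIV. R $ i $ j * \<theta> ^ d j) / 2"
      using row by (simp add: w_def right_diff_distrib sum_subtractf sum_divide_distrib)
    ultimately show ?thesis by (simp add: w_def)
  qed
  with w show ?thesis by blast
qed

section \<open>The flow of a multicommodity dynamical flow network\<close>

lemma flow_is_solution:
  assumes "MDFN M lam f" "x \<in> state_space"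
  shows "is_solution M lam f x (\<lambda>t. flow M lam f t x)"
proof -
  have "\<exists>u. is_solution M lam f x u" using assms by (auto simp: MDFN_def well_posed_def)
  then show ?thesis unfolding flow_def by (rule someI_ex)
qed

lemma solution_unique:
  assumes "MDFN M lam f" "is_solution M lam f x u" "is_solution M lam f x v" "x \<in> state_space" "0 \<le> t"
  shows "u t = v t"
  using assms unfolding MDFN_def well_posed_def by metis

lemma solution_shift:
  assumes u: "is_solution M lam f x u" and "0 \<le> s"
  shows "is_solution M lam f (u s) (\<lambda>t. u (s + t))"
  unfolding is_solution_def
proof (intro conjI allI impI)
  fix t :: real assume "0 \<le> t"
  then have st: "0 \<le> s + t" using \<open>0 \<le> s\<close> by simp
  then show "u (s + t) \<in> state_space" using u by (simp add: is_solution_def)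
  have "(u has_vector_derivative vector_field M lam f (u (s + t))) (at (s + t) within {0..})"
    using u st by (simp add: is_solution_def)
  then have "(u has_vector_derivative vector_field M lam f (u (s + t))) (at (s + t) within (+) s ` {0..})"
    by (rule has_vector_derivative_within_subset) (use \<open>0 \<le> s\<close> in auto)
  moreover have "((+) s has_vector_derivative 1) (at t within {0..})"
    by (auto intro!: derivative_eq_intros)
  ultimately have "(u \<circ> (+) s has_vector_derivative 1 *\<^sub>R vector_field M lam f (u (s + t))) (at t within {0..})"
    by (intro vector_diff_chain_within) auto
  then show "((\<lambda>t. u (s + t)) has_vector_derivative vector_field M lam f (u (s + t))) (at t within {0..})"
    by (simp add: o_def)
qed simp

lemma solution_continuous_on:
  assumes "is_solution M lam f x u" shows "continuous_on {0..} u"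
  unfolding continuous_on_eq_continuous_within
  using assms by (auto simp: is_solution_def intro: has_vector_derivative_continuous)

text \<open>
  The flow at \<open>c\<close> is constant only for nonnegative times; the constant solution makes \<open>c\<close>
  itself available for comparison with other solutions.
\<close>

lemma equilibrium_solution:
  fixes M :: "('v, 'e::finite, 'k::finite) transport_net"
  assumes "MDFN M lam f" "equilibrium (flow M lam f) c"
  shows "is_solution M lam f c (\<lambda>_. c)"
  unfolding is_solution_def
proof (intro conjI allI impI)
  show c: "c \<in> state_space" using assms(2) by (simp add: equilibrium_def)
  have const: "flow M lam f s c = c" if "0 \<le> s" for s
    using assms(2) that by (simp add: equilibrium_def)
  fix t :: real assume "0 \<le> t"
  then have "((\<lambda>s. flow M lam f s c) has_vector_derivative vector_field M lam f c) (at t within {0..})"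
    using flow_is_solution[OF assms(1) c] const by (simp add: is_solution_def)
  then show "((\<lambda>_. c) has_vector_derivative vector_field M lam f c) (at t within {0..})"
    by (rule has_vector_derivative_transform[rotated 2]) (use \<open>0 \<le> t\<close> const in auto)
qed simp

lemma MDFN_semiflow:
  fixes M :: "('v, 'e::finite, 'k::finite) transport_net"
  assumes "MDFN M lam f"
  shows "semiflow (flow M lam f)"
  unfolding semiflow_def
proof (intro ballI conjI allI impI)
  fix x :: "real^'k^'e" assume x: "x \<in> state_space"
  note sol = flow_is_solution[OF assms x]
  show "flow M lam f 0 x = x" using sol by (simp add: is_solution_def)
  show "continuous_on {0..} (\<lambda>t. flow M lam f t x)" using sol by (rule solution_continuous_on)
  show inX: "flow M lam f t x \<in> state_space" if "0 \<le> t" for t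
    using sol that by (simp add: is_solution_def)
  show "flow M lam f (s + t) x = flow M lam f t (flow M lam f s x)" if "0 \<le> s" "0 \<le> t" for s t
    using solution_unique[OF assms solution_shift[OF sol that(1)]
        flow_is_solution[OF assms inX[OF that(1)]] inX[OF that(1)] that(2)] .
qed

text \<open>
  The row sums of the routing matrix are \<open>1\<close> off the off-ramps, so there the total outflow is the
  demand; at the off-ramps this holds by definition of the outflow.
\<close>

lemma vector_field_free_flow:
  assumes "MTN M" "MDFN M lam f" "x \<in> free_flow_region M"
  shows "vector_field M lam f x $ i $ k =
    lam $ i $ k + (\<Sum>j\<in>UNIV. routing M k $ j $ i * demand_fn M j k (x $ j $ k))
      - demand_fn M i k (x $ i $ k)"
proof -
  have f: "f i j k x = routing M k $ i $ j * demand_fn M i k (x $ i $ k)" for i j k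
    using assms by (simp add: MDFN_def)
  have "outflow M f i k x = demand_fn M i k (x $ i $ k)"
  proof (cases "i \<in> off_ramps M")
    case False
    then have "(\<Sum>j\<in>UNIV. routing M k $ i $ j) = 1"
      using assms by (auto simp: MTN_def is_routing_def)
    then show ?thesis using False by (simp add: outflow_def f sum_distrib_right[symmetric])
  qed (simp add: outflow_def)
  then show ?thesis by (simp add: vector_field_def f)
qed

text \<open>
  A demand difference in cell \<open>j\<close> decreases the weighted distance at rate \<open>w j k\<close> times its modulus
  by leaving \<open>j\<close>, and increases it by at most \<open>\<Sum>i. R j i * w i k\<close> times its modulus by entering the
  successors of \<open>j\<close>. Unit weights give nonexpansiveness, weights with \<open>R w < w\<close> give decay.
\<close>

lemma weighted_distance_right_slope:
  fixes M :: "('v, 'e::finite, 'k::finite) transport_net"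
  assumes mtn: "MTN M" and mdfn: "MDFN M lam f"
    and u: "is_solution M lam f x u" and v: "is_solution M lam f y v"
    and "0 \<le> t" and uF: "u t \<in> free_flow_region M" and vF: "v t \<in> free_flow_region M"
    and w: "\<And>i k. 0 \<le> w i k"
  shows "right_slope_le (\<lambda>s. \<Sum>i\<in>UNIV. \<Sum>k\<in>UNIV. w i k * \<bar>v s $ i $ k - u s $ i $ k\<bar>) t
    (- (\<Sum>j\<in>UNIV. \<Sum>k\<in>UNIV. (w j k - (\<Sum>i\<in>UNIV. routing M k $ j $ i * w i k)) *
      \<bar>demand_fn M j k (v t $ j $ k) - demand_fn M j k (u t $ j $ k)\<bar>))"
    (is "right_slope_le _ t ?rate")
proof -
  define b where "b i k = demand_fn M i k (v t $ i $ k) - demand_fn M i k (u t $ i $ k)" for i k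
  define a where "a i k = (\<Sum>j\<in>UNIV. routing M k $ j $ i * b j k)" for i k
  have R: "0 \<le> routing M k $ i $ j" for i j k
    using mtn by (simp add: MTN_def is_routing_def)
  have comp: "right_slope_le (\<lambda>s. \<bar>v s $ i $ k - u s $ i $ k\<bar>) t (\<bar>a i k\<bar> - \<bar>b i k\<bar>)" for i k
  proof (rule right_slope_le_abs)
    have der: "((\<lambda>s. z s $ i $ k) has_vector_derivative vector_field M lam f (z t) $ i $ k) (at_right t)"
      if "is_solution M lam f z0 z" for z z0
    proof -
      have "(z has_vector_derivative vector_field M lam f (z t)) (at t within {0..})"
        using that \<open>0 \<le> t\<close> by (simp add: is_solution_def)
      then have "(z has_vector_derivative vector_field M lam f (z t)) (at_right t)"
        by (rule has_vector_derivative_within_subset) (use \<open>0 \<le> t\<close> in auto)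
      moreover have "bounded_linear (\<lambda>z::real^'k^'e. z $ i $ k)"
        by (intro bounded_linear_compose[OF bounded_linear_vec_nth bounded_linear_vec_nth])
      ultimately show ?thesis by (rule bounded_linear.has_vector_derivative[rotated])
    qed
    have "vector_field M lam f (v t) $ i $ k - vector_field M lam f (u t) $ i $ k = a i k - b i k"
      unfolding vector_field_free_flow[OF mtn mdfn uF] vector_field_free_flow[OF mtn mdfn vF]
      by (simp add: a_def b_def right_diff_distrib sum_subtractf)
    then show "((\<lambda>s. v s $ i $ k - u s $ i $ k) has_vector_derivative a i k - b i k) (at_right t)"
      using has_vector_derivative_diff[OF der[OF v] der[OF u]] by simp
    have "0 \<le> u t $ i $ k" "0 \<le> v t $ i $ k"
      using uF vF by (auto simp: free_flow_region_def state_space_def)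
    then show "0 \<le> (v t $ i $ k - u t $ i $ k) * b i k"
      unfolding b_def using mtn by (intro demand_difference_sign) (auto simp: MTN_def)
  qed (simp add: b_def)
  have "right_slope_le (\<lambda>s. \<Sum>i\<in>UNIV. \<Sum>k\<in>UNIV. w i k * \<bar>v s $ i $ k - u s $ i $ k\<bar>) t
      (\<Sum>i\<in>UNIV. \<Sum>k\<in>UNIV. w i k * (\<bar>a i k\<bar> - \<bar>b i k\<bar>))"
    by (intro right_slope_le_sum right_slope_le_cmult comp w) auto
  then show ?thesis
  proof (rule right_slope_le_mono)
    \<comment> \<open>triangle inequality for the inflows, then collecting the terms by cell of origin\<close>
    have "(\<Sum>i\<in>UNIV. \<Sum>k\<in>UNIV. w i k * (\<bar>a i k\<bar> - \<bar>b i k\<bar>)) \<le>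
        (\<Sum>i\<in>UNIV. \<Sum>k\<in>UNIV. w i k * ((\<Sum>j\<in>UNIV. routing M k $ j $ i * \<bar>b j k\<bar>) - \<bar>b i k\<bar>))"
      by (intro sum_mono mult_left_mono diff_right_mono w)
        (auto simp: a_def abs_mult R intro!: order.trans[OF sum_abs])
    also have "\<dots> = (\<Sum>k\<in>UNIV. \<Sum>i\<in>UNIV. \<Sum>j\<in>UNIV. routing M k $ j $ i * w i k * \<bar>b j k\<bar>)
        - (\<Sum>k\<in>UNIV. \<Sum>i\<in>UNIV. w i k * \<bar>b i k\<bar>)"
      by (subst sum.swap) (simp add: right_diff_distrib sum_subtractf sum_distrib_left mult_ac)
    also have "(\<Sum>k\<in>UNIV. \<Sum>i\<in>UNIV. \<Sum>j\<in>UNIV. routing M k $ j $ i * w i k * \<bar>b j k\<bar>) =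
        (\<Sum>k\<in>UNIV. \<Sum>j\<in>UNIV. \<Sum>i\<in>UNIV. routing M k $ j $ i * w i k * \<bar>b j k\<bar>)"
      by (intro sum.cong refl sum.swap)
    also have "\<dots> - (\<Sum>k\<in>UNIV. \<Sum>i\<in>UNIV. w i k * \<bar>b i k\<bar>) = ?rate"
      unfolding b_def[symmetric]
      by (subst (4) sum.swap) (simp add: left_diff_distrib sum_subtractf sum_distrib_right)
    finally show "(\<Sum>i\<in>UNIV. \<Sum>k\<in>UNIV. w i k * (\<bar>a i k\<bar> - \<bar>b i k\<bar>)) \<le> ?rate" .
  qed
qed

lemma free_flow_nonexpansive:
  assumes mtn: "MTN M" and mdfn: "MDFN M lam f" and D: "D \<subseteq> free_flow_region M"
  shows "l1_nonexpansive_on (flow M lam f) D"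
  unfolding l1_nonexpansive_on_def
proof (intro ballI allI impI)
  fix x y T t
  assume x: "x \<in> D" and y: "y \<in> D" and "0 \<le> T" and t: "t \<in> {0..T}"
    and stay: "\<forall>s\<in>{0..T}. flow M lam f s x \<in> D \<and> flow M lam f s y \<in> D"
  let ?u = "\<lambda>t. flow M lam f t x" and ?v = "\<lambda>t. flow M lam f t y"
  have X: "x \<in> state_space" "y \<in> state_space" using x y D by (auto simp: free_flow_region_def)
  note u = flow_is_solution[OF mdfn X(1)] and v = flow_is_solution[OF mdfn X(2)]
  have "l1_norm (?v t - ?u t) \<le> l1_norm (?v 0 - ?u 0) + 0 * (t - 0)"
  proof (rule growth_le_of_right_slope_le)
    show "continuous_on {0..t} (\<lambda>s. l1_norm (?v s - ?u s))"
      by (intro continuous_on_l1_norm continuous_on_diff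
          continuous_on_subset[OF solution_continuous_on[OF u]]
          continuous_on_subset[OF solution_continuous_on[OF v]]) auto
    show "right_slope_le (\<lambda>s. l1_norm (?v s - ?u s)) s 0" if s: "0 \<le> s" "s < t" for s
    proof -
      have F: "?u s \<in> free_flow_region M" "?v s \<in> free_flow_region M"
        using stay s t D by auto
      have "(\<Sum>i\<in>UNIV. routing M k $ j $ i) \<le> 1" for j k
        using mtn by (cases "j \<in> off_ramps M") (auto simp: MTN_def is_routing_def)
      then show ?thesis
        using right_slope_le_mono[OF weighted_distance_right_slope[OF mtn mdfn u v s(1) F, of "\<lambda>_ _. 1"], of 0]
        by (simp add: l1_norm_def sum_nonneg)
    qed
  qed (use t in auto)
  then show "l1_norm (?v t - ?u t) \<le> l1_norm (y - x)"
    using u v by (simp add: is_solution_def)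
qed

text \<open>
  Supplies and demands are only known to be continuous on the nonnegative reals, so the strict inequalities
  defining the region persist nearby only within the state space.
\<close>

lemma free_flow_region_relatively_open:
  fixes M :: "('v, 'e::finite, 'k::finite) transport_net"
  assumes mtn: "MTN M" and c: "c \<in> free_flow_region M"
  shows "\<exists>r>0. \<forall>x\<in>state_space. l1_norm (x - c) < r \<longrightarrow> x \<in> free_flow_region M"
proof -
  define g where "g i x = supply_fn M i (\<Sum>k\<in>UNIV. x $ i $ k) -
    (\<Sum>k\<in>UNIV. \<Sum>j\<in>UNIV. routing M k $ j $ i * demand_fn M j k (x $ j $ k))" for i and x :: "real^'k^'e"
  have "\<exists>r>0. \<forall>x\<in>state_space. l1_norm (x - c) < r \<longrightarrow> i \<notin> on_ramps M \<longrightarrow> 0 < g i x" for i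
  proof (cases "i \<in> on_ramps M")
    case True
    then show ?thesis by (intro exI[of _ 1]) auto
  next
    case False
    then obtain L where "L-lipschitz_on {0..} (supply_fn M i)"
      using mtn by (auto simp: MTN_def is_supply_def)
    then have supply_cont: "continuous_on {0..} (supply_fn M i)" by (rule lipschitz_on_continuous_on)
    have "continuous_on state_space (\<lambda>x. supply_fn M i (\<Sum>k\<in>UNIV. x $ i $ k))"
      by (rule continuous_on_compose2[OF supply_cont])
        (auto intro!: continuous_intros sum_nonneg simp: state_space_def)
    moreover have "continuous_on state_space (\<lambda>x. demand_fn M j k (x $ j $ k))" for j k
      by (rule continuous_on_compose2[OF demand_continuous_on])
        (use mtn in \<open>auto intro!: continuous_intros simp: MTN_def state_space_def\<close>)
    ultimately have "continuous_on state_space (g i)"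
      unfolding g_def by (intro continuous_on_diff continuous_on_sum continuous_on_mult_left)
    moreover have "c \<in> state_space" "0 < g i c"
      using c False by (auto simp: free_flow_region_def g_def)
    ultimately obtain r where r: "r > 0" "\<And>x. x \<in> state_space \<Longrightarrow> dist x c < r \<Longrightarrow> dist (g i x) (g i c) < g i c"
      unfolding continuous_on_iff by metis
    have "0 < g i x" if "x \<in> state_space" "l1_norm (x - c) < r" for x
    proof -
      have "dist x c < r" using norm_le_l1_norm[of "x - c"] that by (simp add: dist_norm)
      from r(2)[OF that(1) this] show ?thesis by (simp add: dist_real_def)
    qed
    with r(1) show ?thesis by auto
  qed
  then obtain r where r: "\<And>i. 0 < r i"
    "\<And>i x. x \<in> state_space \<Longrightarrow> l1_norm (x - c) < r i \<Longrightarrow> i \<notin> on_ramps M \<Longrightarrow> 0 < g i x"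
    by metis
  obtain r0 where r0: "r0 > 0" "\<And>i. r0 \<le> r i"
    using finite_positive_lower_bound[of r] r(1) by auto
  show ?thesis
  proof (intro exI[of _ r0] conjI ballI impI)
    fix x assume x: "x \<in> state_space" "l1_norm (x - c) < r0"
    have "0 < g i x" if "i \<notin> on_ramps M" for i
      by (rule r(2)[OF x(1) _ that]) (use x(2) r0(2)[of i] in simp)
    with x show "x \<in> free_flow_region M" by (auto simp: free_flow_region_def g_def)
  qed (fact r0)
qed

text \<open>
  For \<open>r\<close> small enough, a trajectory within distance \<open>r\<close> of \<open>c\<close> is in free flow, and each demand
  difference is at least a fixed multiple of the density difference. With the strict weights,
  the weighted distance \<open>V\<close> then has slope at most \<open>- \<kappa> * V\<close>, so it is divided by
  \<open>1 + \<kappa> * T = 4\<close> in time \<open>T = 3 / \<kappa>\<close>. One factor \<open>2\<close> is lost in passing between \<open>V\<close> and the \<open>l\<^sub>1\<close> norm,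
  because the weights lie between \<open>1 / 2\<close> and \<open>1\<close>.
\<close>

lemma local_halving:
  fixes M :: "('v, 'e::finite, 'k::finite) transport_net"
  assumes mtn: "MTN M" and mdfn: "MDFN M lam f"
    and c: "c \<in> free_flow_region M" and eq: "equilibrium (flow M lam f) c"
  shows "\<exists>r>0. \<exists>T\<ge>0. \<forall>q\<in>state_space. (\<forall>t\<ge>0. l1_norm (flow M lam f t q - c) \<le> r) \<longrightarrow>
    l1_norm (flow M lam f T q - c) \<le> l1_norm (q - c) / 2"
proof -
  let ?d = "demand_fn M"
  obtain r1 where r1: "r1 > 0"
    "\<And>x. x \<in> state_space \<Longrightarrow> l1_norm (x - c) < r1 \<Longrightarrow> x \<in> free_flow_region M"
    using free_flow_region_relatively_open[OF mtn c] by blast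
  have cX: "c \<in> state_space" using c by (simp add: free_flow_region_def)
  have "\<exists>r m. 0 < r \<and> 0 < m \<and> (\<forall>b\<ge>0. \<bar>b - c $ i $ k\<bar> \<le> r \<longrightarrow>
      m * \<bar>b - c $ i $ k\<bar> \<le> \<bar>?d i k b - ?d i k (c $ i $ k)\<bar>)" for i k
    using demand_local_expansion[of "?d i k" "c $ i $ k"] mtn cX
    by (auto simp: MTN_def state_space_def)
  then obtain r2 m where r2m: "\<And>i k. 0 < r2 i k" "\<And>i k. 0 < m i k"
    "\<And>i k b. 0 \<le> b \<Longrightarrow> \<bar>b - c $ i $ k\<bar> \<le> r2 i k \<Longrightarrow>
      m i k * \<bar>b - c $ i $ k\<bar> \<le> \<bar>?d i k b - ?d i k (c $ i $ k)\<bar>"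
    by metis
  obtain r3 where r3: "r3 > 0" "\<And>i k. r3 \<le> r2 i k"
    using finite_positive_lower_bound[of "\<lambda>(i, k). r2 i k"] r2m(1) by auto
  have "\<exists>w::'e \<Rightarrow> real. \<forall>i. 1 / 2 \<le> w i \<and> w i \<le> 1 \<and> (\<Sum>j\<in>UNIV. routing M k $ i $ j * w j) < w i" for k
    using mtn by (intro routing_strict_weights[of M]) (simp add: MTN_def)
  then obtain w' where w': "\<And>k i. 1 / 2 \<le> w' k i \<and> w' k i \<le> 1 \<and>
      (\<Sum>j\<in>UNIV. routing M k $ i $ j * w' k j) < w' k i"
    by metis
  define w where "w i k = w' k i" for i k
  have w: "1 / 2 \<le> w i k" "w i k \<le> 1" "(\<Sum>j\<in>UNIV. routing M k $ i $ j * w j k) < w i k" for i k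
    using w'[where k = k and i = i] by (auto simp: w_def)
  have w0: "0 \<le> w i k" for i k using w(1)[of i k] by simp
  obtain \<kappa> where \<kappa>: "\<kappa> > 0"
    "\<And>i k. \<kappa> \<le> (w i k - (\<Sum>j\<in>UNIV. routing M k $ i $ j * w j k)) * m i k"
    using finite_positive_lower_bound[of
        "\<lambda>(i, k). (w i k - (\<Sum>j\<in>UNIV. routing M k $ i $ j * w j k)) * m i k"] w(3) r2m(2)
    by auto
  define r where "r = min (r1 / 2) r3"
  have "l1_norm (flow M lam f (3 / \<kappa>) q - c) \<le> l1_norm (q - c) / 2"
    if q: "q \<in> state_space" and close: "\<forall>t\<ge>0. l1_norm (flow M lam f t q - c) \<le> r" for q
  proof -
    define v where "v t = flow M lam f t q" for t
    define V where "V t = (\<Sum>i\<in>UNIV. \<Sum>k\<in>UNIV. w i k * \<bar>v t $ i $ k - c $ i $ k\<bar>)" for t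
    have sol: "is_solution M lam f q v"
      using flow_is_solution[OF mdfn q] by (simp add: v_def[abs_def])
    have vX: "v t \<in> state_space" if "0 \<le> t" for t
      using sol that by (simp add: is_solution_def)
    have upper: "V t \<le> l1_norm (v t - c)" for t
      unfolding V_def l1_norm_def using w(2) w0
      by (auto intro!: sum_mono mult_left_le_one_le)
    have lower: "l1_norm (v t - c) \<le> 2 * V t" for t
    proof -
      have "\<bar>v t $ i $ k - c $ i $ k\<bar> \<le> 2 * (w i k * \<bar>v t $ i $ k - c $ i $ k\<bar>)" for i k
        using mult_right_mono[OF w(1)[of i k], of "\<bar>v t $ i $ k - c $ i $ k\<bar>"] by simp
      then show ?thesis
        unfolding V_def l1_norm_def sum_distrib_left by (auto intro!: sum_mono)
    qed
    have "V (3 / \<kappa>) * (1 + \<kappa> * (3 / \<kappa>)) \<le> V 0"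
    proof (rule decay_of_right_slope_le)
      show "continuous_on {0..3 / \<kappa>} V"
        unfolding V_def
        by (intro continuous_intros continuous_on_subset[OF solution_continuous_on[OF sol]]) auto
      show "0 \<le> V t" for t
        unfolding V_def using w0 by (intro sum_nonneg mult_nonneg_nonneg) auto
      show "right_slope_le V t (- \<kappa> * V t)" if t: "0 \<le> t" for t
      proof -
        let ?\<Delta> = "\<lambda>i k. \<bar>?d i k (v t $ i $ k) - ?d i k (c $ i $ k)\<bar>"
        let ?gap = "\<lambda>i k. w i k - (\<Sum>j\<in>UNIV. routing M k $ i $ j * w j k)"
        have near: "l1_norm (v t - c) \<le> r" using close t by (simp add: v_def)
        have vF: "v t \<in> free_flow_region M"
          using near r1(1) by (intro r1(2) vX t) (simp add: r_def)
        have slope: "right_slope_le V t (- (\<Sum>i\<in>UNIV. \<Sum>k\<in>UNIV. ?gap i k * ?\<Delta> i k))"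
          unfolding V_def
          by (rule weighted_distance_right_slope[OF mtn mdfn equilibrium_solution[OF mdfn eq] sol t c vF w0])
        have "\<kappa> * V t \<le> (\<Sum>i\<in>UNIV. \<Sum>k\<in>UNIV. \<kappa> * \<bar>v t $ i $ k - c $ i $ k\<bar>)"
          using upper[of t] \<kappa>(1) by (simp add: l1_norm_def sum_distrib_left[symmetric])
        also have "\<dots> \<le> (\<Sum>i\<in>UNIV. \<Sum>k\<in>UNIV. ?gap i k * ?\<Delta> i k)"
        proof (intro sum_mono)
          fix i k
          have "\<bar>v t $ i $ k - c $ i $ k\<bar> \<le> r2 i k"
            using l1_norm_component_le[of "v t - c" i k] near r3(2)[of i k] by (simp add: r_def)
          then have "m i k * \<bar>v t $ i $ k - c $ i $ k\<bar> \<le> ?\<Delta> i k"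
            using vX[OF t] by (intro r2m(3)) (auto simp: state_space_def)
          then have "?gap i k * (m i k * \<bar>v t $ i $ k - c $ i $ k\<bar>) \<le> ?gap i k * ?\<Delta> i k"
            using w(3)[of k i] by (intro mult_left_mono) auto
          moreover have "\<kappa> * \<bar>v t $ i $ k - c $ i $ k\<bar> \<le> ?gap i k * m i k * \<bar>v t $ i $ k - c $ i $ k\<bar>"
            by (intro mult_right_mono \<kappa>(2)) auto
          ultimately show "\<kappa> * \<bar>v t $ i $ k - c $ i $ k\<bar> \<le> ?gap i k * ?\<Delta> i k"
            by (simp add: mult.assoc)
        qed
        finally show ?thesis by (intro right_slope_le_mono[OF slope]) simp
      qed
    qed (use \<kappa> in auto)
    then have "4 * V (3 / \<kappa>) \<le> V 0" using \<kappa>(1) by simp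
    with lower[of "3 / \<kappa>"] upper[of 0] show ?thesis
      using sol by (simp add: v_def is_solution_def)
  qed
  moreover have "r > 0" "3 / \<kappa> \<ge> 0" using r1(1) r3(1) \<kappa>(1) by (auto simp: r_def)
  ultimately show ?thesis by blast
qed

theorem theorem1:
  fixes M :: "('v::finite, 'e::finite, 'k::finite) transport_net"
    and lam :: "real^'k^'e"
    and f :: "('e, 'k) flows"
    and xs :: "real^'k^'e"
    and \<delta>bar \<delta>star :: ereal
  assumes "MTN M"
    and "lam \<in> stability_region M"
    and "MDFN M lam f"
    and "xs \<in> free_flow_region M"
    and "equilibrium (flow M lam f) xs"
    and "\<delta>bar = (INF x \<in> state_space - free_flow_region M. ereal (l1_norm (x - xs)))"
    and "\<delta>star = Sup {ereal \<delta> | \<delta>. \<delta> > 0 \<and> l1_nonexpansive_on (flow M lam f) (l1_ball xs (ereal \<delta>))}"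
  shows "\<delta>bar > 0 \<and>
    asymptotically_stable (flow M lam f) xs \<and>
    l1_ball xs \<delta>bar \<subseteq> l1_ball xs \<delta>star \<and>
    l1_ball xs \<delta>star \<subseteq> region_of_attraction (flow M lam f) xs"
proof -
  let ?\<phi> = "flow M lam f"
  note sf = MDFN_semiflow[OF assms(3)] and eq = assms(5)
  obtain r where r: "r > 0"
    "\<And>x. x \<in> state_space \<Longrightarrow> l1_norm (x - xs) < r \<Longrightarrow> x \<in> free_flow_region M"
    using free_flow_region_relatively_open[OF assms(1,4)] by blast
  have "ereal r \<le> \<delta>bar"
    unfolding assms(6) using r(2) by (intro INF_greatest) (force simp: not_less[symmetric])
  moreover have "0 < ereal r" using r(1) by simp
  ultimately have bar: "\<delta>bar > 0" by (rule less_le_trans[rotated])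
  have ne: "l1_nonexpansive_on ?\<phi> (l1_ball xs (ereal \<delta>))" if "ereal \<delta> \<le> \<delta>bar" for \<delta>
  proof (rule free_flow_nonexpansive[OF assms(1,3)])
    show "l1_ball xs (ereal \<delta>) \<subseteq> free_flow_region M"
    proof
      fix x assume x: "x \<in> l1_ball xs (ereal \<delta>)"
      show "x \<in> free_flow_region M"
      proof (rule ccontr)
        assume "x \<notin> free_flow_region M"
        then have "\<delta>bar \<le> ereal (l1_norm (x - xs))"
          unfolding assms(6) using x by (intro INF_lower) (auto simp: mem_l1_ball)
        with that have "ereal \<delta> \<le> ereal (l1_norm (x - xs))" by (rule order_trans)
        with x show False by (simp add: mem_l1_ball)
      qed
    qed
  qed
  obtain \<rho> T where \<rho>T: "\<rho> > 0" "T \<ge> 0"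
    "\<And>q. q \<in> state_space \<Longrightarrow> (\<And>t. 0 \<le> t \<Longrightarrow> l1_norm (?\<phi> t q - xs) \<le> \<rho>) \<Longrightarrow>
      l1_norm (?\<phi> T q - xs) \<le> l1_norm (q - xs) / 2"
    using local_halving[OF assms(1,3,4,5)] by blast
  have attr: "l1_ball xs (ereal \<delta>) \<subseteq> region_of_attraction ?\<phi> xs"
    if "l1_nonexpansive_on ?\<phi> (l1_ball xs (ereal \<delta>))" for \<delta>
    using ball_attracted[OF sf eq that \<rho>T] by blast
  have "asymptotically_stable ?\<phi> xs"
    unfolding asymptotically_stable_def
    using stable_of_nonexpansive[OF sf eq ne[OF \<open>ereal r \<le> \<delta>bar\<close>] r(1)]
      attr[OF ne[OF \<open>ereal r \<le> \<delta>bar\<close>]] r(1) by auto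
  moreover have "l1_ball xs \<delta>bar \<subseteq> l1_ball xs \<delta>star"
  proof
    fix x assume x: "x \<in> l1_ball xs \<delta>bar"
    then have "ereal (l1_norm (x - xs)) < \<delta>bar" by (simp add: l1_ball_def)
    then obtain \<delta> where \<delta>: "ereal (l1_norm (x - xs)) < ereal \<delta>" "ereal \<delta> < \<delta>bar"
      using ereal_dense2 by blast
    then have "\<delta> > 0" using l1_norm_nonneg[of "x - xs"] by simp
    then have "ereal \<delta> \<le> \<delta>star"
      unfolding assms(7) using ne[of \<delta>] \<delta>(2) by (intro Sup_upper) auto
    with \<delta>(1) have "ereal (l1_norm (x - xs)) < \<delta>star" by (rule less_le_trans)
    with x show "x \<in> l1_ball xs \<delta>star" by (simp add: l1_ball_def)
  qed
  moreover have "l1_ball xs \<delta>star \<subseteq> region_of_attraction ?\<phi> xs"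
  proof
    fix x assume x: "x \<in> l1_ball xs \<delta>star"
    then have "ereal (l1_norm (x - xs)) < \<delta>star" by (simp add: l1_ball_def)
    then obtain \<delta> where "ereal (l1_norm (x - xs)) < ereal \<delta>"
      "l1_nonexpansive_on ?\<phi> (l1_ball xs (ereal \<delta>))"
      unfolding assms(7) less_Sup_iff by blast
    with x attr show "x \<in> region_of_attraction ?\<phi> xs" by (auto simp: l1_ball_def)
  qed
  ultimately show ?thesis using bar by blast
qed

end
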